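(* Let $(M,\lambda_i(x,y))$ be a GAP-space of dimension $n$. (a) If $g_{\mu\nu}(x,y):=\sum_{i=1}^n\lambda_{i\mu}(x,y)\,\lambda_{i\nu}(x,y)$, then $(M,g)$ is a generalized Lagrange space. (b) If $L(x,y):=g_{\mu\nu}(x,y)\,y^\mu y^\nu$ and $g$ satisfies $y^\mu\,\dot\partial_\alpha g_{\mu\nu}=0$ for all $\alpha,\nu$, then $(M,L)$ is a Lagrange space. (c) If $F(x,y):=\sqrt{g_{\mu\nu}(x,y)\,y^\mu y^\nu}$ and (1) the tensor $\dot\partial_\alpha g_{\mu\nu}$ is totally symmetric in $\alpha,\mu,\nu$, and (2) each $\lambda_i(x,y)$ is positively homogeneous of degree zero in $y$, then $(M,F)$ is a Finsler space.
   Context: $M$ is a smooth $n$-dimensional manifold, $\pi:TM\to M$ its tangent bundle, $\tau M:=TM\setminus\{0\}$ the slit tangent bundle, $(x^\mu,y^\mu)$ the coordinates on $TM$ induced by coordinates $(x^\mu)$ on $M$, and $\dot\partial_\mu:=\partial/\partial y^\mu$. Repeated Greek indices are summed. The pullback bundle $\pi^{-1}(TM)$ has fibre $T_xM$ over $(x,y)$; a section $X$ has components $X^\alpha(x,y)$ with $X^{\alpha'}=\frac{\partial x^{\alpha'}}{\partial x^\alpha}X^\alpha$ under change of coordinates. Tensor fields on the pullback bundle have components depending on $(x,y)$ which transform under changes of coordinates on $M$ like tensors on $M$. GAP-space (generalized absolute parallelism space): an $n$-dimensional manifold $M$ with $n$ global sections $\lambda_i$ ($i=1,\dots,n$) of $\pi^{-1}(TM)$,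 smooth over $\tau M$ and linearly independent at each point. $\lambda_i^\alpha$ are the components of $\lambda_i$ and $(\lambda_{i\alpha})$ is the inverse matrix: $\sum_i\lambda_i^\alpha\lambda_{i\beta}=\delta^\alpha_\beta$, $\lambda_i^\alpha\lambda_{j\alpha}=\delta_{ij}$. Generalized Lagrange space: a pair $(M,g(x,y))$ with $g$ a symmetric non-degenerate tensor field of type $(0,2)$ on the pullback bundle $\pi^{-1}(TM)$, i.e. with components $g_{\mu\nu}(x,y)$ depending on $(x,y)$ which transform under changes of coordinates on $M$ like the components of a $(0,2)$-tensor on $M$. Lagrange space: a pair $(M,L)$ with $L:TM\to\mathbb R$ that is $C^\infty$ on $\tau M$, $C^0$ on $TM$, and whose Hessian $\frac12\dot\partial_\alpha\dot\partial_\beta L$ is non-degenerate at each point of $\tau M$. Finsler space: a pair $(M,F)$ with $F:TM\to\mathbb R$ such that $F$ is $C^\infty$ on $\tau M$ and $C^0$ on $TM$; $F\ge 0$ and $F(x,y)=0\iff y=0$; $F(x,ay)=aF(x,y)$ for all $a>0$; and $\frac12\dot\partial_\alpha\dot\partial_\beta F^2$ is positive definite at each point of $\tau M$. The functions $L$ and $F$ are given the value $0$ at $y=0$. *)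

theory Defs
  imports "HOL-Analysis.Analysis"
begin

(* Intended for open S only, where all derivatives are two-sided. *)
primrec Ck_on :: "nat \<Rightarrow> 'a::euclidean_space set \<Rightarrow> ('a \<Rightarrow> 'b::real_normed_vector) \<Rightarrow> bool" where
  "Ck_on 0 S f \<longleftrightarrow> continuous_on S f"
| "Ck_on (Suc k) S f \<longleftrightarrow>
     (\<forall>x\<in>S. f differentiable (at x)) \<and> (\<forall>v. Ck_on k S (\<lambda>x. frechet_derivative f (at x) v))"

definition smooth_on :: "'a::euclidean_space set \<Rightarrow> ('a \<Rightarrow> 'b::real_normed_vector) \<Rightarrow> bool" where
  "smooth_on S f \<longleftrightarrow> (\<forall>k. Ck_on k S f)"

(* A chart is a domain together with a coordinate map, which is only relevant on the domain.
   The dimension of the manifold is CARD('n). *)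
type_synonym ('m, 'n) chart = "'m set \<times> ('m \<Rightarrow> real^'n)"

abbreviation cdom :: "('m, 'n::finite) chart \<Rightarrow> 'm set" where "cdom c \<equiv> fst c"
abbreviation cmap :: "('m, 'n::finite) chart \<Rightarrow> 'm \<Rightarrow> real^'n" where "cmap c \<equiv> snd c"
abbreviation cimage :: "('m, 'n::finite) chart \<Rightarrow> (real^'n) set" where "cimage c \<equiv> cmap c ` cdom c"
abbreviation cinv :: "('m, 'n::finite) chart \<Rightarrow> real^'n \<Rightarrow> 'm" where
  "cinv c \<equiv> inv_into (cdom c) (cmap c)"

definition transition :: "('m, 'n::finite) chart \<Rightarrow> ('m, 'n) chart \<Rightarrow> real^'n \<Rightarrow> real^'n" where
  "transition c d = cmap d \<circ> cinv c"

(* A may be any smooth atlas, in particular a maximal one. *)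
definition smooth_manifold :: "'m topology \<Rightarrow> ('m, 'n::finite) chart set \<Rightarrow> bool" where
  "smooth_manifold M A \<longleftrightarrow>
     Hausdorff_space M \<and> second_countable M \<and>
     topspace M = (\<Union>c\<in>A. cdom c) \<and>
     (\<forall>c\<in>A. openin M (cdom c) \<and> open (cimage c) \<and>
        homeomorphic_map (subtopology M (cdom c)) (top_of_set (cimage c)) (cmap c)) \<and>
     (\<forall>c\<in>A. \<forall>d\<in>A. smooth_on (cmap c ` (cdom c \<inter> cdom d)) (transition c d))"

(* With c giving coordinates x and d giving coordinates x',
   jac c d p $ \<alpha>' $ \<alpha> is the partial derivative of x'^\<alpha>' with respect to x^\<alpha> at p. *)
definition jac :: "('m, 'n::finite) chart \<Rightarrow> ('m, 'n) chart \<Rightarrow> 'm \<Rightarrow> real^'n^'n" where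
  "jac c d p = jacobian (transition c d) (at (cmap c p))"

(* A tangent vector at p is the family of its component vectors in all charts around p,
   related by the transformation law of vectors. The value 0 at all other charts is a dummy
   that makes the representation unique. Linear operations are pointwise. *)
type_synonym ('m, 'n) tvec = "('m, 'n) chart \<Rightarrow> real^'n"

definition tangent_space :: "('m, 'n::finite) chart set \<Rightarrow> 'm \<Rightarrow> ('m, 'n) tvec set" where
  "tangent_space A p = {\<xi>.
     (\<forall>c\<in>A. \<forall>d\<in>A. p \<in> cdom c \<inter> cdom d \<longrightarrow>
        (\<forall>\<alpha>'. \<xi> d $ \<alpha>' = (\<Sum>\<alpha>\<in>UNIV. jac c d p $ \<alpha>' $ \<alpha> * \<xi> c $ \<alpha>))) \<and>
     (\<forall>c. \<not> (c \<in> A \<and> p \<in> cdom c) \<longrightarrow> \<xi> c = 0)}"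

definition tzero :: "('m, 'n::finite) tvec" where
  "tzero = (\<lambda>c. 0)"

definition tscale :: "real \<Rightarrow> ('m, 'n::finite) tvec \<Rightarrow> ('m, 'n) tvec" where
  "tscale a \<xi> = (\<lambda>c. a *\<^sub>R \<xi> c)"

definition tangent_bundle ::
    "'m topology \<Rightarrow> ('m, 'n::finite) chart set \<Rightarrow> ('m \<times> ('m, 'n) tvec) set" where
  "tangent_bundle M A = {(p, \<xi>). p \<in> topspace M \<and> \<xi> \<in> tangent_space A p}"

definition slit_tangent_bundle ::
    "'m topology \<Rightarrow> ('m, 'n::finite) chart set \<Rightarrow> ('m \<times> ('m, 'n) tvec) set" where
  "slit_tangent_bundle M A = {(p, \<xi>) \<in> tangent_bundle M A. \<xi> \<noteq> tzero}"

(* The point of TM with coordinates (x, y) in the coordinate system induced by the chart c,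
   for x in the image of c. *)
definition tb_point ::
    "('m, 'n::finite) chart set \<Rightarrow> ('m, 'n) chart \<Rightarrow> (real^'n) \<times> (real^'n) \<Rightarrow> 'm \<times> ('m, 'n) tvec" where
  "tb_point A c = (\<lambda>(x, y).
     (cinv c x, \<lambda>d. if d \<in> A \<and> cinv c x \<in> cdom d then jac c d (cinv c x) *v y else 0))"

(* Partial derivative of a coordinate expression f(x, y) with respect to y^\<alpha>. *)
definition ydot :: "'n::finite \<Rightarrow> ((real^'n) \<times> (real^'n) \<Rightarrow> real) \<Rightarrow> (real^'n) \<times> (real^'n) \<Rightarrow> real" where
  "ydot \<alpha> f = (\<lambda>(x, y). deriv (\<lambda>t. f (x, y + t *\<^sub>R axis \<alpha> 1)) 0)"

definition slit_coords :: "('m, 'n::finite) chart \<Rightarrow> ((real^'n) \<times> (real^'n)) set" where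
  "slit_coords c = cimage c \<times> (- {0})"

definition smooth_on_slit ::
    "('m, 'n::finite) chart set \<Rightarrow> ('m \<times> ('m, 'n) tvec \<Rightarrow> real) \<Rightarrow> bool" where
  "smooth_on_slit A f \<longleftrightarrow> (\<forall>c\<in>A. smooth_on (slit_coords c) (f \<circ> tb_point A c))"

(* The topology of TM is the one for which the induced coordinate systems are homeomorphisms. *)
definition continuous_on_tb ::
    "('m, 'n::finite) chart set \<Rightarrow> ('m \<times> ('m, 'n) tvec \<Rightarrow> real) \<Rightarrow> bool" where
  "continuous_on_tb A f \<longleftrightarrow> (\<forall>c\<in>A. continuous_on (cimage c \<times> UNIV) (f \<circ> tb_point A c))"

(* Values of sections outside the tangent bundle are irrelevant. *)
definition pullback_section ::
    "'m topology \<Rightarrow> ('m, 'n::finite) chart set \<Rightarrow> ('m \<times> ('m, 'n) tvec \<Rightarrow> ('m, 'n) tvec) \<Rightarrow> bool" where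
  "pullback_section M A X \<longleftrightarrow> (\<forall>(p, \<xi>) \<in> tangent_bundle M A. X (p, \<xi>) \<in> tangent_space A p)"

(* g c u $ \<mu> $ \<nu> is the (\<mu>, \<nu>)-component at the point u of TM in the chart c. *)
type_synonym ('m, 'n) tensor02 = "('m, 'n) chart \<Rightarrow> 'm \<times> ('m, 'n) tvec \<Rightarrow> real^'n^'n"

(* As usual for tensor fields, the components are required to be smooth over the slit
   tangent bundle. *)
definition tensor_field02 ::
    "'m topology \<Rightarrow> ('m, 'n::finite) chart set \<Rightarrow> ('m, 'n) tensor02 \<Rightarrow> bool" where
  "tensor_field02 M A g \<longleftrightarrow>
     (\<forall>(p, \<xi>) \<in> tangent_bundle M A. \<forall>c\<in>A. \<forall>d\<in>A. p \<in> cdom c \<inter> cdom d \<longrightarrow>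
        (\<forall>\<mu>' \<nu>'. g d (p, \<xi>) $ \<mu>' $ \<nu>' =
           (\<Sum>\<mu>\<in>UNIV. \<Sum>\<nu>\<in>UNIV. jac d c p $ \<mu> $ \<mu>' * jac d c p $ \<nu> $ \<nu>' * g c (p, \<xi>) $ \<mu> $ \<nu>))) \<and>
     (\<forall>c\<in>A. \<forall>\<mu> \<nu>. smooth_on (slit_coords c) (\<lambda>z. g c (tb_point A c z) $ \<mu> $ \<nu>))"

definition nondegenerate :: "real^'n^'n \<Rightarrow> bool" where
  "nondegenerate B \<longleftrightarrow> (\<forall>v. (\<forall>w. v \<bullet> (B *v w) = 0) \<longrightarrow> v = 0)"

definition positive_definite :: "real^'n^'n \<Rightarrow> bool" where
  "positive_definite B \<longleftrightarrow> (\<forall>v. v \<noteq> 0 \<longrightarrow> v \<bullet> (B *v v) > 0)"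

(* The function g_\<mu>\<nu>(x,y) y^\<mu> y^\<nu> on TM, evaluated in some chart around the base point;
   for a tensor field g the choice of the chart does not matter.
   At y = 0 the formula gives 0. *)
definition energy ::
    "('m, 'n::finite) chart set \<Rightarrow> ('m, 'n) tensor02 \<Rightarrow> 'm \<times> ('m, 'n) tvec \<Rightarrow> real" where
  "energy A g = (\<lambda>(p, \<xi>).
     let c = (SOME c. c \<in> A \<and> p \<in> cdom c)
     in \<Sum>\<mu>\<in>UNIV. \<Sum>\<nu>\<in>UNIV. g c (p, \<xi>) $ \<mu> $ \<nu> * \<xi> c $ \<mu> * \<xi> c $ \<nu>)"

definition ydot_metric ::
    "('m, 'n::finite) chart set \<Rightarrow> ('m, 'n) tensor02 \<Rightarrow> ('m, 'n) chart \<Rightarrow> 'n \<Rightarrow> 'n \<Rightarrow> 'n \<Rightarrow>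
     (real^'n) \<times> (real^'n) \<Rightarrow> real" where
  "ydot_metric A g c \<alpha> \<mu> \<nu> = ydot \<alpha> (\<lambda>z. g c (tb_point A c z) $ \<mu> $ \<nu>)"

definition half_hessian ::
    "('m, 'n::finite) chart set \<Rightarrow> ('m \<times> ('m, 'n) tvec \<Rightarrow> real) \<Rightarrow> ('m, 'n) chart \<Rightarrow>
     (real^'n) \<times> (real^'n) \<Rightarrow> real^'n^'n" where
  "half_hessian A L c z = (\<chi> \<alpha> \<beta>. 1/2 * ydot \<alpha> (ydot \<beta> (L \<circ> tb_point A c)) z)"

type_synonym ('m, 'n) frame = "'n \<Rightarrow> 'm \<times> ('m, 'n) tvec \<Rightarrow> ('m, 'n) tvec"

(* No regularity is required at y = 0, but the sections live over all of TM. *)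
definition gap_space ::
    "'m topology \<Rightarrow> ('m, 'n::finite) chart set \<Rightarrow> ('m, 'n) frame \<Rightarrow> bool" where
  "gap_space M A lam \<longleftrightarrow>
     smooth_manifold M A \<and>
     (\<forall>i. pullback_section M A (lam i)) \<and>
     (\<forall>i. \<forall>c\<in>A. smooth_on (slit_coords c) (\<lambda>z. lam i (tb_point A c z) c)) \<and>
     (\<forall>u \<in> tangent_bundle M A. \<forall>a :: 'n \<Rightarrow> real.
        (\<lambda>c. \<Sum>i\<in>UNIV. a i *\<^sub>R lam i u c) = tzero \<longrightarrow> (\<forall>i. a i = 0))"

(* frame_lower lam c u $ i $ \<mu> is \<lambda>_{i\<mu>}. The library inverse of the matrix with entries
   \<lambda>_i^\<alpha> (row \<alpha>, column i) carries the index i on its rows. *)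
definition frame_lower ::
    "('m, 'n::finite) frame \<Rightarrow> ('m, 'n) chart \<Rightarrow> 'm \<times> ('m, 'n) tvec \<Rightarrow> real^'n^'n" where
  "frame_lower lam c u = matrix_inv (\<chi> \<alpha> i. lam i u c $ \<alpha>)"

definition gap_metric :: "('m, 'n::finite) frame \<Rightarrow> ('m, 'n) tensor02" where
  "gap_metric lam c u = (\<chi> \<mu> \<nu>. \<Sum>i\<in>UNIV. frame_lower lam c u $ i $ \<mu> * frame_lower lam c u $ i $ \<nu>)"

definition generalized_lagrange_space ::
    "'m topology \<Rightarrow> ('m, 'n::finite) chart set \<Rightarrow> ('m, 'n) tensor02 \<Rightarrow> bool" where
  "generalized_lagrange_space M A g \<longleftrightarrow>
     smooth_manifold M A \<and> tensor_field02 M A g \<and>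
     (\<forall>(p, \<xi>) \<in> tangent_bundle M A. \<forall>c\<in>A. p \<in> cdom c \<longrightarrow>
        (\<forall>\<mu> \<nu>. g c (p, \<xi>) $ \<mu> $ \<nu> = g c (p, \<xi>) $ \<nu> $ \<mu>) \<and> nondegenerate (g c (p, \<xi>)))"

definition lagrange_space ::
    "'m topology \<Rightarrow> ('m, 'n::finite) chart set \<Rightarrow> ('m \<times> ('m, 'n) tvec \<Rightarrow> real) \<Rightarrow> bool" where
  "lagrange_space M A L \<longleftrightarrow>
     smooth_manifold M A \<and> smooth_on_slit A L \<and> continuous_on_tb A L \<and>
     (\<forall>c\<in>A. \<forall>z \<in> slit_coords c. nondegenerate (half_hessian A L c z))"

definition finsler_space ::
    "'m topology \<Rightarrow> ('m, 'n::finite) chart set \<Rightarrow> ('m \<times> ('m, 'n) tvec \<Rightarrow> real) \<Rightarrow> bool" where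
  "finsler_space M A F \<longleftrightarrow>
     smooth_manifold M A \<and> smooth_on_slit A F \<and> continuous_on_tb A F \<and>
     (\<forall>(p, \<xi>) \<in> tangent_bundle M A. F (p, \<xi>) \<ge> 0 \<and> (F (p, \<xi>) = 0 \<longleftrightarrow> \<xi> = tzero)) \<and>
     (\<forall>(p, \<xi>) \<in> tangent_bundle M A. \<forall>a>0. F (p, tscale a \<xi>) = a * F (p, \<xi>)) \<and>
     (\<forall>c\<in>A. \<forall>z \<in> slit_coords c. positive_definite (half_hessian A (\<lambda>u. (F u)\<^sup>2) c z))"

definition totally_symmetric3 :: "('n \<Rightarrow> 'n \<Rightarrow> 'n \<Rightarrow> real) \<Rightarrow> bool" where
  "totally_symmetric3 T \<longleftrightarrow> (\<forall>\<alpha> \<mu> \<nu>. T \<alpha> \<mu> \<nu> = T \<mu> \<alpha> \<nu> \<and> T \<alpha> \<mu> \<nu> = T \<alpha> \<nu> \<mu>)"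

definition homogeneous_degree0 ::
    "'m topology \<Rightarrow> ('m, 'n::finite) chart set \<Rightarrow> ('m \<times> ('m, 'n) tvec \<Rightarrow> ('m, 'n) tvec) \<Rightarrow> bool" where
  "homogeneous_degree0 M A X \<longleftrightarrow>
     (\<forall>(p, \<xi>) \<in> slit_tangent_bundle M A. \<forall>a>0. X (p, tscale a \<xi>) = X (p, \<xi>))"

end

theory Submission
  imports Defs
begin

text \<open>
  Write \<open>B\<close> for the matrix \<open>\<lambda>\<^bsub>i\<mu>\<^esub>\<close> of the covariant frame components in a chart. Then
  \<open>g = B\<^sup>T B\<close>. Since \<open>B\<close> is invertible, \<open>g\<close> is positive definite at every point of \<open>TM\<close>; since
  the frame components transform with the Jacobian of the coordinate change, \<open>B\<close> transforms with
  its inverse and \<open>g\<close> is a tensor; since matrix inversion is smooth by Cramer's rule, so is \<open>g\<close>.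
  The energy \<open>g\<^bsub>\<mu>\<nu>\<^esub> y\<^sup>\<mu> y\<^sup>\<nu>\<close> is \<open>\<bar>B y\<bar>\<^sup>2\<close>, which no change of chart affects
  (\<open>energy_eq_norm\<close>) and which vanishes only at \<open>y = 0\<close>.

  What the hypothesis of (b), the Euler condition \<open>y\<^sup>\<mu> \<partial>g\<^bsub>\<mu>\<nu>\<^esub>/\<partial>y\<^sup>\<alpha> = 0\<close>, gives is local
  and is proved for an arbitrary field of matrices on a product \<open>U \<times> (- {0})\<close> (locale
  \<open>Euler_metric\<close>). By the product rule the momenta \<open>y\<^sup>\<mu> g\<^bsub>\<mu>\<nu>\<^esub>\<close> have derivatives
  \<open>g\<^bsub>\<alpha>\<nu>\<^esub>\<close>, so half the Hessian of the energy is \<open>g\<close> itself, hence nondegenerate. The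
  delicate point is continuity on the zero section, because \<open>g\<close> has in general no limit there.
  Contracting the Euler condition with \<open>y\<^sup>\<alpha>\<close> shows that \<open>y\<^sup>\<mu> g\<^bsub>\<mu>\<nu>\<^esub>(x, t y)\<close> does not depend
  on \<open>t > 0\<close>; hence the energy is homogeneous of degree two in \<open>y\<close>, locally bounded by a
  multiple of \<open>\<bar>y\<bar>\<^sup>2\<close>, and so tends to 0.

  Part (c) reduces to (b): if the frame is homogeneous of degree zero, then so is \<open>g\<close>, and
  Euler's theorem gives \<open>y\<^sup>\<mu> \<partial>g\<^bsub>\<alpha>\<nu>\<^esub>/\<partial>y\<^sup>\<mu> = 0\<close>; total symmetry exchanges \<open>\<alpha>\<close> and \<open>\<mu>\<close>.
  Half the Hessian of \<open>F\<^sup>2\<close> is then the positive definite \<open>g\<close>, and \<open>F\<close> is smooth on the slit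
  bundle as the square root of a positive smooth function.
\<close>

section \<open>Calculus of \<open>k\<close> times differentiable functions\<close>

lemma Ck_on_cong:
  assumes "open S" "\<And>x. x \<in> S \<Longrightarrow> f x = g x" "Ck_on k S f"
  shows "Ck_on k S g"
  using assms
proof (induction k arbitrary: f g)
  case 0
  then show ?case using continuous_on_cong[of S S f g] by simp
next
  case (Suc k)
  have deriv: "(g has_derivative frechet_derivative f (at x)) (at x)" if "x \<in> S" for x
    using Suc.prems that
    by (intro has_derivative_transform_within_open[of f _ x UNIV S g])
       (auto simp flip: frechet_derivative_works)
  have eq: "frechet_derivative f (at x) = frechet_derivative g (at x)" if "x \<in> S" for x
    using frechet_derivative_at[OF deriv[OF that]] .
  have "Ck_on k S (\<lambda>x. frechet_derivative g (at x) v)" for v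
    by (rule Suc.IH[of "\<lambda>x. frechet_derivative f (at x) v"]) (use Suc.prems eq in auto)
  then show ?case
    using deriv by (auto simp: differentiable_def)
qed

text \<open>Lets the derivative be given by a formula valid on \<open>S\<close> only; the closure properties
  under linear maps, sums, products, inverses and roots are inductions whose step differentiates
  once and applies this rule.\<close>

lemma Ck_on_SucI:
  assumes "open S" "\<And>x. x \<in> S \<Longrightarrow> (f has_derivative D x) (at x)" "\<And>v. Ck_on k S (\<lambda>x. D x v)"
  shows "Ck_on (Suc k) S f"
proof -
  have "D x = frechet_derivative f (at x)" if "x \<in> S" for x
    using frechet_derivative_at[OF assms(2)[OF that]] .
  then have "Ck_on k S (\<lambda>x. frechet_derivative f (at x) v)" for v
    using Ck_on_cong[OF \<open>open S\<close> _ assms(3)[of v]] by simp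
  with assms(2) show ?thesis
    by (auto simp: differentiable_def)
qed

lemma Ck_on_SucD:
  assumes "Ck_on (Suc k) S f"
  shows "Ck_on k S f"
  using assms
proof (induction k arbitrary: f)
  case 0
  then show ?case
    by (auto intro: differentiable_imp_continuous_on simp: differentiable_on_def
        differentiable_at_withinI)
next
  case (Suc k)
  have "Ck_on k S (\<lambda>x. frechet_derivative f (at x) v)" for v
    using Suc.IH Suc.prems by auto
  then show ?case
    using Suc.prems by simp
qed

lemma Ck_on_const: "open S \<Longrightarrow> Ck_on k S (\<lambda>x. c)"
  by (induction k arbitrary: c) (auto simp: Ck_on_SucI)

lemma Ck_on_bounded_linear:
  assumes "bounded_linear h" "open S" "Ck_on k S f"
  shows "Ck_on k S (\<lambda>x. h (f x))"
  using assms(3)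
proof (induction k arbitrary: f)
  case 0
  then show ?case
    using bounded_linear.continuous_on[OF assms(1)] by simp
next
  case (Suc k)
  show ?case
  proof (rule Ck_on_SucI[OF \<open>open S\<close>])
    show "((\<lambda>x. h (f x)) has_derivative (\<lambda>v. h (frechet_derivative f (at x) v))) (at x)"
      if "x \<in> S" for x
      using Suc.prems that
      by (intro bounded_linear.has_derivative[OF assms(1)]) (simp flip: frechet_derivative_works)
  qed (use Suc in auto)
qed

lemma Ck_on_ident:
  assumes "open S"
  shows "Ck_on k S (\<lambda>x. x)"
proof (cases k)
  case (Suc k')
  show ?thesis
    unfolding Suc by (rule Ck_on_SucI[OF assms, of _ "\<lambda>x v. v"]) (auto intro: Ck_on_const[OF assms])
qed auto

lemma Ck_on_add:
  assumes "open S" "Ck_on k S f" "Ck_on k S g"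
  shows "Ck_on k S (\<lambda>x. f x + g x)"
  using assms(2,3)
proof (induction k arbitrary: f g)
  case (Suc k)
  show ?case
  proof (rule Ck_on_SucI[OF \<open>open S\<close>])
    show "((\<lambda>x. f x + g x) has_derivative
        (\<lambda>v. frechet_derivative f (at x) v + frechet_derivative g (at x) v)) (at x)"
      if "x \<in> S" for x
      using Suc.prems that by (intro has_derivative_add) (auto simp flip: frechet_derivative_works)
  qed (use Suc in auto)
qed (auto intro: continuous_intros)

lemma Ck_on_mult:
  fixes f g :: "'a::euclidean_space \<Rightarrow> real"
  assumes "open S" "Ck_on k S f" "Ck_on k S g"
  shows "Ck_on k S (\<lambda>x. f x * g x)"
  using assms(2,3)
proof (induction k arbitrary: f g)
  case (Suc k)
  show ?case
  proof (rule Ck_on_SucI[OF \<open>open S\<close>])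
    show "((\<lambda>x. f x * g x) has_derivative
        (\<lambda>v. f x * frechet_derivative g (at x) v + frechet_derivative f (at x) v * g x)) (at x)"
      if "x \<in> S" for x
      using Suc.prems that by (intro has_derivative_mult) (auto simp flip: frechet_derivative_works)
  next
    fix v
    have "Ck_on k S f" "Ck_on k S g"
      using Suc.prems Ck_on_SucD by auto
    then show "Ck_on k S
        (\<lambda>x. f x * frechet_derivative g (at x) v + frechet_derivative f (at x) v * g x)"
      using Suc.prems by (intro Ck_on_add[OF \<open>open S\<close>] Suc.IH) auto
  qed
qed (auto intro: continuous_intros)

text \<open>The derivative of \<open>1/f\<close> is a polynomial in \<open>1/f\<close> and the derivative of \<open>f\<close>, so the order of
  differentiability of \<open>1/f\<close> bootstraps itself; \<open>sqrt f\<close> is treated in the same way.\<close>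

lemma Ck_on_inverse:
  fixes f :: "'a::euclidean_space \<Rightarrow> real"
  assumes "open S" "\<And>x. x \<in> S \<Longrightarrow> f x \<noteq> 0" "Ck_on k S f"
  shows "Ck_on k S (\<lambda>x. inverse (f x))"
  using assms(3)
proof (induction k)
  case 0
  then show ?case
    using assms(2) by (auto intro: continuous_intros)
next
  case (Suc k)
  show ?case
  proof (rule Ck_on_SucI[OF \<open>open S\<close>])
    show "((\<lambda>x. inverse (f x)) has_derivative
        (\<lambda>v. (- 1) * (inverse (f x) * frechet_derivative f (at x) v * inverse (f x)))) (at x)"
      if "x \<in> S" for x
      using Suc.prems that assms(2)
      by (auto intro!: derivative_eq_intros simp flip: frechet_derivative_works)
  next
    fix v
    have "Ck_on k S (\<lambda>x. inverse (f x))"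
      using Suc Ck_on_SucD by blast
    then show "Ck_on k S
        (\<lambda>x. (- 1) * (inverse (f x) * frechet_derivative f (at x) v * inverse (f x)))"
      using Suc.prems \<open>open S\<close> by (intro Ck_on_mult Ck_on_const) auto
  qed
qed

lemma Ck_on_sqrt:
  assumes "open S" "\<And>x. x \<in> S \<Longrightarrow> f x > 0" "Ck_on k S f"
  shows "Ck_on k S (\<lambda>x. sqrt (f x))"
  using assms(3)
proof (induction k)
  case 0
  then show ?case
    by (auto intro: continuous_intros)
next
  case (Suc k)
  show ?case
  proof (rule Ck_on_SucI[OF \<open>open S\<close>])
    show "((\<lambda>x. sqrt (f x)) has_derivative
        (\<lambda>v. 1/2 * (inverse (sqrt (f x)) * frechet_derivative f (at x) v))) (at x)"
      if "x \<in> S" for x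
    proof -
      have "(f has_derivative frechet_derivative f (at x)) (at x)"
        using Suc.prems that by (simp flip: frechet_derivative_works)
      from has_derivative_real_sqrt[OF assms(2)[OF that] this] show ?thesis
        by (simp add: field_simps)
    qed
  next
    fix v
    have "Ck_on k S (\<lambda>x. inverse (sqrt (f x)))"
    proof (rule Ck_on_inverse[OF \<open>open S\<close>])
      show "sqrt (f x) \<noteq> 0" if "x \<in> S" for x
        using assms(2)[OF that] by simp
    qed (use Suc Ck_on_SucD in blast)
    then show "Ck_on k S (\<lambda>x. 1/2 * (inverse (sqrt (f x)) * frechet_derivative f (at x) v))"
      using Suc.prems \<open>open S\<close> by (intro Ck_on_mult Ck_on_const) auto
  qed
qed

lemma Ck_on_sum:
  assumes "open S" "\<And>i. i \<in> I \<Longrightarrow> Ck_on k S (f i)"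
  shows "Ck_on k S (\<lambda>x. \<Sum>i\<in>I. f i x)"
  using assms(2)
  by (induction I rule: infinite_finite_induct)
     (auto intro: Ck_on_const Ck_on_add \<open>open S\<close>)

lemma Ck_on_prod:
  fixes f :: "'i \<Rightarrow> 'a::euclidean_space \<Rightarrow> real"
  assumes "open S" "\<And>i. i \<in> I \<Longrightarrow> Ck_on k S (f i)"
  shows "Ck_on k S (\<lambda>x. \<Prod>i\<in>I. f i x)"
  using assms(2)
  by (induction I rule: infinite_finite_induct)
     (auto intro: Ck_on_const Ck_on_mult \<open>open S\<close>)

lemma Ck_on_det:
  fixes B :: "'a::euclidean_space \<Rightarrow> real^'n^'n"
  assumes "open S" "\<And>i j. Ck_on k S (\<lambda>x. B x $ i $ j)"
  shows "Ck_on k S (\<lambda>x. det (B x))"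
  unfolding det_def
  by (intro Ck_on_sum Ck_on_mult Ck_on_const Ck_on_prod assms)

lemma
  fixes B :: "real^'n^'n"
  assumes "invertible B"
  shows matrix_inv_right: "B ** matrix_inv B = mat 1"
    and matrix_inv_left: "matrix_inv B ** B = mat 1"
proof -
  have "B ** matrix_inv B = mat 1 \<and> matrix_inv B ** B = mat 1"
    using assms unfolding invertible_def matrix_inv_def by (rule someI_ex)
  then show "B ** matrix_inv B = mat 1" "matrix_inv B ** B = mat 1"
    by auto
qed

text \<open>By Cramer's rule each entry of the inverse is a quotient of determinants, which are polynomials
  in the entries of the matrix.\<close>

lemma Ck_on_matrix_inv:
  fixes B :: "'a::euclidean_space \<Rightarrow> real^'n^'n"
  assumes "open S" "\<And>x. x \<in> S \<Longrightarrow> invertible (B x)" "\<And>i j. Ck_on k S (\<lambda>x. B x $ i $ j)"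
  shows "Ck_on k S (\<lambda>x. matrix_inv (B x) $ i $ j)"
proof (rule Ck_on_cong[OF \<open>open S\<close>])
  let ?C = "\<lambda>x. (\<chi> r s. if s = i then axis j 1 $ r else B x $ r $ s) :: real^'n^'n"
  show "det (?C x) * inverse (det (B x)) = matrix_inv (B x) $ i $ j" if "x \<in> S" for x
  proof -
    have "B x *v column j (matrix_inv (B x)) = axis j 1"
      using matrix_inv_right[OF assms(2)[OF that]]
      by (metis matrix_vector_mul_assoc matrix_vector_mul_lid matrix_vector_mult_basis)
    moreover have "det (B x) \<noteq> 0"
      using assms(2)[OF that] by (simp add: invertible_det_nz)
    ultimately have "column j (matrix_inv (B x)) =
        (\<chi> l. det (\<chi> r s. if s = l then axis j 1 $ r else B x $ r $ s) / det (B x))"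
      by (rule cramer[THEN iffD1, rotated])
    then have "column j (matrix_inv (B x)) $ i = det (?C x) / det (B x)"
      by simp
    then show ?thesis
      by (simp add: column_def field_simps)
  qed
  have "Ck_on k S (\<lambda>x. ?C x $ r $ s)" for r s
    using assms(3) by (cases "s = i") (auto intro: Ck_on_const \<open>open S\<close>)
  then show "Ck_on k S (\<lambda>x. det (?C x) * inverse (det (B x)))"
    using assms by (intro Ck_on_mult Ck_on_inverse Ck_on_det) (auto simp: invertible_det_nz)
qed

lemma smooth_on_differentiable: "smooth_on S f \<Longrightarrow> x \<in> S \<Longrightarrow> f differentiable (at x)"
  by (metis smooth_on_def Ck_on.simps(2))

lemma smooth_on_continuous: "smooth_on S f \<Longrightarrow> continuous_on S f"
  by (metis smooth_on_def Ck_on.simps(1))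

section \<open>Derivatives in the fibre directions\<close>

lemma
  fixes f :: "(real^'n) \<times> (real^'n) \<Rightarrow> real"
  assumes "f differentiable (at z)"
  shows ydot_has_derivative: "((\<lambda>t. f (fst z, snd z + t *\<^sub>R axis \<alpha> 1)) has_field_derivative ydot \<alpha> f z) (at 0)"
    and ydot_eq_frechet_derivative: "ydot \<alpha> f z = frechet_derivative f (at z) (0, axis \<alpha> 1)"
proof -
  let ?D = "frechet_derivative f (at z)"
  have D: "(f has_derivative ?D) (at (fst z, snd z + 0 *\<^sub>R axis \<alpha> 1))"
    using assms by (simp flip: frechet_derivative_works)
  have path: "((\<lambda>t::real. (fst z, snd z + t *\<^sub>R axis \<alpha> 1)) has_derivative
      (\<lambda>h. (0, h *\<^sub>R axis \<alpha> 1))) (at 0)"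
    by (auto intro!: derivative_eq_intros)
  have "((\<lambda>t. f (fst z, snd z + t *\<^sub>R axis \<alpha> 1)) has_derivative
      (\<lambda>h. ?D (0, h *\<^sub>R axis \<alpha> 1))) (at 0)"
    using has_derivative_compose[OF path D] .
  moreover have "?D (0, h *\<^sub>R axis \<alpha> 1) = ?D (0, axis \<alpha> 1) * h" for h
    using linear_scale[OF linear_frechet_derivative[OF assms], of h "(0, axis \<alpha> 1)"] by simp
  ultimately have *: "((\<lambda>t. f (fst z, snd z + t *\<^sub>R axis \<alpha> 1)) has_field_derivative
      ?D (0, axis \<alpha> 1)) (at 0)"
    by (simp add: has_field_derivative_def)
  then show "ydot \<alpha> f z = ?D (0, axis \<alpha> 1)"
    by (simp add: ydot_def case_prod_beta DERIV_imp_deriv)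
  with * show "((\<lambda>t. f (fst z, snd z + t *\<^sub>R axis \<alpha> 1)) has_field_derivative ydot \<alpha> f z) (at 0)"
    by simp
qed

lemma ydot_cong:
  assumes "open S" "z \<in> S" "\<And>w. w \<in> S \<Longrightarrow> f w = g w"
    and "f differentiable (at z)"
  shows "ydot \<alpha> f z = ydot \<alpha> g z"
proof -
  have "(g has_derivative frechet_derivative f (at z)) (at z)"
    using assms
    by (intro has_derivative_transform_within_open[of f _ z UNIV S g])
       (auto simp flip: frechet_derivative_works)
  then have "g differentiable (at z)" "frechet_derivative f (at z) = frechet_derivative g (at z)"
    using frechet_derivative_at by (auto simp: differentiable_def)
  with assms(4) show ?thesis
    by (simp add: ydot_eq_frechet_derivative)
qed

lemma derivative_along_ray:
  fixes f :: "(real^'n) \<times> (real^'n) \<Rightarrow> real"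
  assumes "f differentiable (at (x, t *\<^sub>R y))"
  shows "((\<lambda>s. f (x, s *\<^sub>R y)) has_field_derivative
      (\<Sum>\<alpha>\<in>UNIV. y $ \<alpha> * ydot \<alpha> f (x, t *\<^sub>R y))) (at t)"
proof -
  let ?D = "frechet_derivative f (at (x, t *\<^sub>R y))"
  have D: "(f has_derivative ?D) (at (x, t *\<^sub>R y))"
    using assms by (simp flip: frechet_derivative_works)
  have path: "((\<lambda>s::real. (x, s *\<^sub>R y)) has_derivative (\<lambda>h. (0, h *\<^sub>R y))) (at t)"
    by (auto intro!: derivative_eq_intros)
  have lin: "linear ?D"
    using linear_frechet_derivative[OF assms] .
  have "y = (\<Sum>\<alpha>\<in>UNIV. y $ \<alpha> *\<^sub>R axis \<alpha> 1)"
    using basis_expansion[of y] by (simp add: scalar_mult_eq_scaleR)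
  then have "(0, y) = (\<Sum>\<alpha>\<in>UNIV. y $ \<alpha> *\<^sub>R (0::real^'n, axis \<alpha> 1 :: real^'n))"
    by (simp add: prod_eq_iff fst_sum snd_sum)
  then have "?D (0, y) = (\<Sum>\<alpha>\<in>UNIV. y $ \<alpha> * ydot \<alpha> f (x, t *\<^sub>R y))"
    by (simp add: linear_sum[OF lin] linear_scale[OF lin]
        ydot_eq_frechet_derivative[OF assms] del: scaleR_Pair)
  moreover have "?D (0, h *\<^sub>R y) = ?D (0, y) * h" for h
    using linear_scale[OF lin, of h "(0, y)"] by simp
  ultimately show ?thesis
    using has_derivative_compose[OF path D] by (simp add: has_field_derivative_def)
qed

lemma positive_ray_constant:
  fixes f :: "real \<Rightarrow> real"
  assumes "\<And>t. t > 0 \<Longrightarrow> (f has_field_derivative 0) (at t)" "t > 0"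
  shows "f t = f 1"
proof -
  obtain k where "\<forall>t\<in>{0<..}. f t = k"
    using has_field_derivative_zero_constant[of "{0<..}" f] assms(1)
    by (auto simp: has_field_derivative_at_within)
  with \<open>t > 0\<close> show ?thesis by auto
qed

section \<open>Metrics satisfying the Euler condition, in coordinates\<close>

text \<open>The coordinate form of the situation in a single chart: \<open>U\<close> is the range of the chart and \<open>G\<close>
  the matrix of metric components.\<close>

locale Euler_metric =
  fixes U :: "(real^'n) set" and G :: "(real^'n) \<times> (real^'n) \<Rightarrow> real^'n^'n"
  assumes open_U: "open U"
    and smooth: "\<And>\<mu> \<nu>. smooth_on (U \<times> (- {0})) (\<lambda>z. G z $ \<mu> $ \<nu>)"
    and sym: "\<And>z \<mu> \<nu>. z \<in> U \<times> (- {0}) \<Longrightarrow> G z $ \<mu> $ \<nu> = G z $ \<nu> $ \<mu>"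
    and Euler: "\<And>z \<alpha> \<nu>. z \<in> U \<times> (- {0}) \<Longrightarrow>
      (\<Sum>\<mu>\<in>UNIV. snd z $ \<mu> * ydot \<alpha> (\<lambda>z. G z $ \<mu> $ \<nu>) z) = 0"
begin

abbreviation S where "S \<equiv> U \<times> (- {0 :: real^'n})"

text \<open>\<open>2 * momentum \<nu>\<close> is the derivative of \<open>quad\<close> in the direction \<open>y\<^sup>\<nu>\<close>
  (\<open>ydot_quad\<close>), that is, the momentum when \<open>quad\<close> is regarded as a Lagrangian.\<close>

definition momentum :: "'n \<Rightarrow> (real^'n) \<times> (real^'n) \<Rightarrow> real" where
  "momentum \<nu> z = (\<Sum>\<mu>\<in>UNIV. snd z $ \<mu> * G z $ \<mu> $ \<nu>)"

definition quad :: "(real^'n) \<times> (real^'n) \<Rightarrow> real" where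
  "quad z = (\<Sum>\<mu>\<in>UNIV. \<Sum>\<nu>\<in>UNIV. G z $ \<mu> $ \<nu> * snd z $ \<mu> * snd z $ \<nu>)"

lemma open_S: "open S"
  using open_U by (intro open_Times) auto

lemma Ck_on_snd_nth: "Ck_on k S (\<lambda>z. snd z $ \<mu>)"
  by (rule Ck_on_bounded_linear[OF _ open_S Ck_on_ident[OF open_S]])
    (rule bounded_linear_compose[OF bounded_linear_vec_nth bounded_linear_snd])

lemma Ck_on_G: "Ck_on k S (\<lambda>z. G z $ \<mu> $ \<nu>)"
  using smooth by (auto simp: smooth_on_def)

lemma smooth_momentum: "smooth_on S (momentum \<nu>)"
  unfolding smooth_on_def momentum_def
  by (intro allI Ck_on_sum Ck_on_mult open_S Ck_on_snd_nth Ck_on_G)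

lemma smooth_quad: "smooth_on S quad"
  unfolding smooth_on_def quad_def
  by (intro allI Ck_on_sum Ck_on_mult open_S Ck_on_snd_nth Ck_on_G)

lemma quad_momentum: "quad z = (\<Sum>\<nu>\<in>UNIV. snd z $ \<nu> * momentum \<nu> z)"
  unfolding quad_def momentum_def sum_distrib_left
  by (subst sum.swap) (simp add: mult_ac)

text \<open>The product rule gives a second term \<open>y\<^sup>\<mu> \<partial>G\<^bsub>\<mu>\<nu>\<^esub>/\<partial>y\<^sup>\<alpha>\<close>, which is what the Euler condition
  kills.\<close>

lemma ydot_momentum:
  assumes "z \<in> S"
  shows "ydot \<alpha> (momentum \<nu>) z = G z $ \<alpha> $ \<nu>"
proof -
  let ?z = "\<lambda>t. (fst z, snd z + t *\<^sub>R axis \<alpha> 1)"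
  have "((\<lambda>t. \<Sum>\<mu>\<in>UNIV. (snd z $ \<mu> + t * axis \<alpha> 1 $ \<mu>) * G (?z t) $ \<mu> $ \<nu>) has_field_derivative
      (\<Sum>\<mu>\<in>UNIV. axis \<alpha> 1 $ \<mu> * G z $ \<mu> $ \<nu> +
          snd z $ \<mu> * ydot \<alpha> (\<lambda>z. G z $ \<mu> $ \<nu>) z)) (at 0)"
    using ydot_has_derivative[OF smooth_on_differentiable[OF smooth assms]]
    by (auto intro!: derivative_eq_intros simp: mult.commute)
  moreover have "(\<Sum>\<mu>\<in>UNIV. axis \<alpha> 1 $ \<mu> * G z $ \<mu> $ \<nu>) = G z $ \<alpha> $ \<nu>"
    by (simp add: axis_def if_distrib[of "\<lambda>a. a * _"] cong: if_cong)
  ultimately show ?thesis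
    using Euler[OF assms]
    by (simp add: ydot_def case_prod_beta momentum_def sum.distrib DERIV_imp_deriv)
qed

text \<open>Differentiating \<open>y\<^sup>\<nu>\<close> in \<open>y\<^sup>\<nu> momentum\<^bsub>\<nu>\<^esub>\<close> gives one copy of the momentum, and by symmetry of
  \<open>G\<close> differentiating the momentum gives the other.\<close>

lemma ydot_quad:
  assumes "z \<in> S"
  shows "ydot \<beta> quad z = 2 * momentum \<beta> z"
proof -
  let ?z = "\<lambda>t. (fst z, snd z + t *\<^sub>R axis \<beta> 1)"
  have "((\<lambda>t. \<Sum>\<nu>\<in>UNIV. (snd z $ \<nu> + t * axis \<beta> 1 $ \<nu>) * momentum \<nu> (?z t)) has_field_derivative
      (\<Sum>\<nu>\<in>UNIV. axis \<beta> 1 $ \<nu> * momentum \<nu> z + snd z $ \<nu> * G z $ \<beta> $ \<nu>)) (at 0)"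
    using ydot_has_derivative[OF smooth_on_differentiable[OF smooth_momentum assms]]
      ydot_momentum[OF assms]
    by (auto intro!: derivative_eq_intros simp: mult.commute)
  moreover have "(\<Sum>\<nu>\<in>UNIV. axis \<beta> 1 $ \<nu> * momentum \<nu> z) = momentum \<beta> z"
    by (simp add: axis_def if_distrib[of "\<lambda>a. a * _"] cong: if_cong)
  moreover have "(\<Sum>\<nu>\<in>UNIV. snd z $ \<nu> * G z $ \<beta> $ \<nu>) = momentum \<beta> z"
    unfolding momentum_def using sym[OF assms] by (intro sum.cong) auto
  ultimately show ?thesis
    by (simp add: ydot_def case_prod_beta quad_momentum sum.distrib DERIV_imp_deriv)
qed

lemma half_hessian_quad:
  assumes "z \<in> S"
  shows "1/2 * ydot \<alpha> (ydot \<beta> quad) z = G z $ \<alpha> $ \<beta>"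
proof -
  have diff: "momentum \<beta> differentiable (at z)"
    using smooth_on_differentiable[OF smooth_momentum assms] .
  then have "ydot \<alpha> (\<lambda>w. 2 * momentum \<beta> w) z = 2 * ydot \<alpha> (momentum \<beta>) z"
    using DERIV_cmult[OF ydot_has_derivative[OF diff], of 2]
    by (simp add: ydot_def case_prod_beta DERIV_imp_deriv)
  moreover have "ydot \<alpha> (\<lambda>w. 2 * momentum \<beta> w) z = ydot \<alpha> (ydot \<beta> quad) z"
    using diff by (intro ydot_cong[OF open_S assms]) (auto simp: ydot_quad)
  ultimately show ?thesis
    using ydot_momentum[OF assms] by simp
qed

text \<open>Along the ray through \<open>y\<close> the sum \<open>y\<^sup>\<mu> G\<^bsub>\<mu>\<nu>\<^esub>\<close>, with \<open>y\<close> held fixed in the first factor, has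
  derivative \<open>y\<^sup>\<alpha> y\<^sup>\<mu> \<partial>G\<^bsub>\<mu>\<nu>\<^esub>/\<partial>y\<^sup>\<alpha>\<close>, which is a contraction of the Euler condition and so 0. The
  components of \<open>G\<close> themselves need not be constant along rays.\<close>

lemma quad_homogeneous:
  assumes "x \<in> U" "y \<noteq> 0" "t > 0"
  shows "quad (x, t *\<^sub>R y) = t\<^sup>2 * quad (x, y)"
proof -
  let ?P = "\<lambda>\<nu> t. \<Sum>\<mu>\<in>UNIV. y $ \<mu> * G (x, t *\<^sub>R y) $ \<mu> $ \<nu>"
  have "(?P \<nu> has_field_derivative 0) (at s)" if "s > 0" for \<nu> s
  proof -
    have z: "(x, s *\<^sub>R y) \<in> S"
      using assms that by auto
    have "(?P \<nu> has_field_derivative (\<Sum>\<mu>\<in>UNIV. y $ \<mu> *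
        (\<Sum>\<alpha>\<in>UNIV. y $ \<alpha> * ydot \<alpha> (\<lambda>z. G z $ \<mu> $ \<nu>) (x, s *\<^sub>R y)))) (at s)"
      by (intro DERIV_sum DERIV_cmult derivative_along_ray smooth_on_differentiable[OF smooth z])
    \<comment> \<open>The Euler condition is available at \<open>s y\<close>, not at \<open>y\<close>, whence the factor \<open>1/s\<close>.\<close>
    also have "(\<Sum>\<mu>\<in>UNIV. y $ \<mu> *
        (\<Sum>\<alpha>\<in>UNIV. y $ \<alpha> * ydot \<alpha> (\<lambda>z. G z $ \<mu> $ \<nu>) (x, s *\<^sub>R y))) =
      (\<Sum>\<alpha>\<in>UNIV. y $ \<alpha> / s *
        (\<Sum>\<mu>\<in>UNIV. (s *\<^sub>R y) $ \<mu> * ydot \<alpha> (\<lambda>z. G z $ \<mu> $ \<nu>) (x, s *\<^sub>R y)))"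
      unfolding sum_distrib_left using that by (subst sum.swap) (simp add: mult_ac)
    also have "\<dots> = 0"
      using Euler[OF z] by simp
    finally show ?thesis .
  qed
  then have "?P \<nu> t = ?P \<nu> 1" for \<nu>
    using positive_ray_constant[of "?P \<nu>"] \<open>t > 0\<close> by blast
  then have "momentum \<nu> (x, t *\<^sub>R y) = t * momentum \<nu> (x, y)" for \<nu>
    by (simp add: momentum_def mult.assoc flip: sum_distrib_left)
  then show ?thesis
    by (simp add: quad_momentum sum_distrib_left power2_eq_square mult_ac)
qed

text \<open>Away from \<open>y = 0\<close> this is part of smoothness. Near a point \<open>(x, 0)\<close> homogeneity bounds \<open>quad\<close> by
  \<open>\<bar>y\<bar>\<^sup>2\<close> times its maximum over unit vectors \<open>y\<close>, which is finite uniformly for base points in a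
  compact ball around \<open>x\<close>.\<close>

lemma continuous_quad: "continuous_on (U \<times> UNIV) quad"
proof -
  have "isCont quad (x, y)" if x: "x \<in> U" for x y
  proof (cases "y = 0")
    case False
    then show ?thesis
      using smooth_on_continuous[OF smooth_quad] continuous_on_eq_continuous_at[OF open_S] x by auto
  next
    case True
    obtain r where r: "r > 0" "cball x r \<subseteq> U"
      using open_U x open_contains_cball by blast
    let ?K = "cball x r \<times> sphere (0 :: real^'n) 1"
    have "continuous_on ?K quad"
      using smooth_on_continuous[OF smooth_quad] by (rule continuous_on_subset) (use r in auto)
    then have "bounded (quad ` ?K)"
      by (intro compact_imp_bounded compact_continuous_image compact_Times) auto
    then obtain B where B: "\<And>z. z \<in> ?K \<Longrightarrow> \<bar>quad z\<bar> \<le> B"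
      by (auto simp: bounded_iff)
    have bound: "\<bar>quad (x', y')\<bar> \<le> B * (norm y')\<^sup>2" if "x' \<in> cball x r" for x' y'
    proof (cases "y' = 0")
      case False
      let ?e = "y' /\<^sub>R norm y'"
      have "quad (x', norm y' *\<^sub>R ?e) = (norm y')\<^sup>2 * quad (x', ?e)"
        using False that r by (intro quad_homogeneous) auto
      then have "\<bar>quad (x', y')\<bar> = (norm y')\<^sup>2 * \<bar>quad (x', ?e)\<bar>"
        using False by (simp add: abs_mult)
      also have "\<dots> \<le> (norm y')\<^sup>2 * B"
        using False that by (intro mult_left_mono B) auto
      finally show ?thesis by (simp add: mult.commute)
    qed (simp add: quad_def)
    have "((\<lambda>z. B * (norm (snd z))\<^sup>2) \<longlongrightarrow> B * (norm (snd (x, y)))\<^sup>2) (at (x, y))"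
      by (intro tendsto_intros)
    then have "((\<lambda>z. B * (norm (snd z))\<^sup>2) \<longlongrightarrow> 0) (at (x, y))"
      using True by simp
    moreover have "\<forall>\<^sub>F z in at (x, y). norm (quad z) \<le> B * (norm (snd z))\<^sup>2"
      unfolding eventually_at_topological
      by (rule exI[of _ "ball x r \<times> UNIV"]) (use r bound in \<open>auto intro!: open_Times\<close>)
    ultimately have "(quad \<longlongrightarrow> 0) (at (x, y))"
      by (rule Lim_null_comparison[rotated])
    moreover have "quad (x, y) = 0"
      using True by (simp add: quad_def)
    ultimately show ?thesis
      by (simp add: isCont_def)
  qed
  then show ?thesis
    by (auto intro: continuous_at_imp_continuous_on)
qed

end

section \<open>Charts, Jacobians and tangent vectors\<close>

locale manifold =
  fixes M :: "'m topology" and A :: "('m, 'n::finite) chart set"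
  assumes manifold: "smooth_manifold M A"
begin

lemma chart_around: "p \<in> topspace M \<Longrightarrow> \<exists>c\<in>A. p \<in> cdom c"
  using manifold by (auto simp: smooth_manifold_def)

lemma cdom_topspace: "c \<in> A \<Longrightarrow> p \<in> cdom c \<Longrightarrow> p \<in> topspace M"
  using manifold by (auto simp: smooth_manifold_def)

lemma open_cimage: "c \<in> A \<Longrightarrow> open (cimage c)"
  using manifold by (auto simp: smooth_manifold_def)

lemma open_slit_coords: "c \<in> A \<Longrightarrow> open (slit_coords c)"
  unfolding slit_coords_def by (intro open_Times open_cimage) auto

lemma chart_homeomorphic:
  assumes "c \<in> A"
  shows "homeomorphic_map (subtopology M (cdom c)) (top_of_set (cimage c)) (cmap c)"
    and "openin M (cdom c)"
  using manifold assms by (auto simp: smooth_manifold_def)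

lemma inj_on_cmap:
  assumes "c \<in> A"
  shows "inj_on (cmap c) (cdom c)"
proof -
  have "topspace (subtopology M (cdom c)) = cdom c"
    using openin_subset[OF chart_homeomorphic(2)[OF assms]] by auto
  then show ?thesis
    using homeomorphic_imp_injective_map[OF chart_homeomorphic(1)[OF assms]] by simp
qed

lemma cinv_cmap: "c \<in> A \<Longrightarrow> p \<in> cdom c \<Longrightarrow> cinv c (cmap c p) = p"
  by (simp add: inv_into_f_f inj_on_cmap)

lemma open_overlap:
  assumes "c \<in> A" "openin M W"
  shows "open (cmap c ` (cdom c \<inter> W))"
proof -
  have "openin (subtopology M (cdom c)) (cdom c \<inter> W)"
    using assms by (auto simp: openin_subtopology)
  then have "openin (top_of_set (cimage c)) (cmap c ` (cdom c \<inter> W))"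
    using homeomorphic_imp_open_map[OF chart_homeomorphic(1)[OF assms(1)]]
    by (simp add: open_map_def)
  then show ?thesis
    using open_cimage[OF assms(1)] by (metis openin_open_eq)
qed

lemma transition_has_derivative:
  assumes "c \<in> A" "d \<in> A" "p \<in> cdom c" "p \<in> cdom d"
  shows "(transition c d has_derivative (\<lambda>v. jac c d p *v v)) (at (cmap c p))"
proof -
  have "smooth_on (cmap c ` (cdom c \<inter> cdom d)) (transition c d)"
    using manifold assms by (auto simp: smooth_manifold_def)
  then have "transition c d differentiable (at (cmap c p))"
    using assms by (intro smooth_on_differentiable) auto
  then show ?thesis
    by (simp add: jac_def flip: jacobian_works)
qed

lemma jac_chain:
  assumes "c \<in> A" "d \<in> A" "e \<in> A" "p \<in> cdom c" "p \<in> cdom d" "p \<in> cdom e"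
  shows "jac c e p = jac d e p ** jac c d p"
proof -
  have "transition c d (cmap c p) = cmap d p"
    using assms by (simp add: transition_def cinv_cmap)
  then have "(transition d e has_derivative (\<lambda>v. jac d e p *v v)) (at (transition c d (cmap c p)))"
    using transition_has_derivative assms by simp
  from has_derivative_compose[OF transition_has_derivative[OF assms(1,2,4,5)] this]
  \<comment> \<open>The composition agrees with \<open>transition c e\<close> only on the open set of points of \<open>c\<close> that also lie in \<open>d\<close>.\<close>
  have comp: "((\<lambda>x. transition d e (transition c d x)) has_derivative
      (\<lambda>v. (jac d e p ** jac c d p) *v v)) (at (cmap c p))"
    by (simp add: matrix_vector_mul_assoc)
  have "(transition c e has_derivative (\<lambda>v. (jac d e p ** jac c d p) *v v)) (at (cmap c p))"
  proof (rule has_derivative_transform_within_open[OF comp])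
    show "open (cmap c ` (cdom c \<inter> cdom d))"
      using open_overlap assms chart_homeomorphic by blast
  qed (use assms in \<open>auto simp: transition_def cinv_cmap\<close>)
  then have "(\<lambda>v. (jac d e p ** jac c d p) *v v) = (\<lambda>v. jac c e p *v v)"
    using transition_has_derivative[OF assms(1,3,4,6)] has_derivative_unique by blast
  then show ?thesis
    by (metis matrix_eq)
qed

lemma jac_self:
  assumes "c \<in> A" "p \<in> cdom c"
  shows "jac c c p = mat 1"
proof -
  have "(transition c c has_derivative (\<lambda>v. v)) (at (cmap c p))"
    by (rule has_derivative_transform_within_open[OF has_derivative_ident open_cimage[OF assms(1)]])
      (use assms in \<open>auto simp: transition_def cinv_cmap\<close>)
  then have "(\<lambda>v. v) = (\<lambda>v. jac c c p *v v)"
    using transition_has_derivative[OF assms(1,1,2,2)] has_derivative_unique by blast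
  then show ?thesis
    by (metis matrix_eq matrix_vector_mul_lid)
qed

lemma jac_inverse:
  assumes "c \<in> A" "d \<in> A" "p \<in> cdom c" "p \<in> cdom d"
  shows "jac d c p ** jac c d p = mat 1"
  using jac_chain[of c d c p] jac_self[of c p] assms by simp

lemma tangent_space_transform:
  assumes "\<xi> \<in> tangent_space A p" "c \<in> A" "d \<in> A" "p \<in> cdom c" "p \<in> cdom d"
  shows "\<xi> d = jac c d p *v \<xi> c"
  using assms by (auto simp: tangent_space_def vec_eq_iff matrix_vector_mult_def)

lemma tangent_space_outside:
  assumes "\<xi> \<in> tangent_space A p" "\<not> (c \<in> A \<and> p \<in> cdom c)"
  shows "\<xi> c = 0"
  using assms unfolding tangent_space_def by blast

text \<open>A tangent vector is determined by its components in any one chart.\<close>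

lemma tangent_space_eq_tzero_iff:
  assumes "\<xi> \<in> tangent_space A p" "c \<in> A" "p \<in> cdom c"
  shows "\<xi> = tzero \<longleftrightarrow> \<xi> c = 0"
proof
  assume "\<xi> c = 0"
  then have "\<xi> d = 0" for d
    using tangent_space_transform[OF assms(1,2) _ assms(3), of d] tangent_space_outside[OF assms(1)]
    by (cases "d \<in> A \<and> p \<in> cdom d") auto
  then show "\<xi> = tzero"
    by (auto simp: tzero_def)
qed (simp add: tzero_def)

text \<open>That the components prescribed by \<open>tb_point\<close> obey the transformation law is the chain rule for
  the Jacobians; that they restrict to \<open>y\<close> in the chart \<open>c\<close> is \<open>jac_self\<close>.\<close>

lemma tb_point_tangent_bundle:
  assumes "c \<in> A" "x \<in> cimage c"
  obtains p \<xi> where "tb_point A c (x, y) = (p, \<xi>)" "(p, \<xi>) \<in> tangent_bundle M A"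
    "p \<in> cdom c" "\<xi> c = y" "cmap c p = x"
proof -
  obtain p where p: "p \<in> cdom c" "x = cmap c p"
    using assms by auto
  define \<xi> where "\<xi> = (\<lambda>d. if d \<in> A \<and> p \<in> cdom d then jac c d p *v y else 0)"
  have tb: "tb_point A c (x, y) = (p, \<xi>)"
    using cinv_cmap[OF assms(1) p(1)] by (simp add: tb_point_def \<xi>_def p(2) cong: if_cong)
  have "\<xi> e $ \<alpha>' = (\<Sum>\<alpha>\<in>UNIV. jac d e p $ \<alpha>' $ \<alpha> * \<xi> d $ \<alpha>)"
    if "d \<in> A" "e \<in> A" "p \<in> cdom d \<inter> cdom e" for d e \<alpha>'
  proof -
    have "\<xi> e = jac d e p *v \<xi> d"
      using that jac_chain[OF assms(1) that(1,2)] p by (simp add: \<xi>_def matrix_vector_mul_assoc)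
    then show ?thesis
      by (simp add: matrix_vector_mult_def)
  qed
  moreover have "\<xi> d = 0" if "\<not> (d \<in> A \<and> p \<in> cdom d)" for d
    unfolding \<xi>_def using that by (rule if_not_P)
  ultimately have "\<xi> \<in> tangent_space A p"
    unfolding tangent_space_def by blast
  then have "(p, \<xi>) \<in> tangent_bundle M A"
    using cdom_topspace[OF assms(1) p(1)] by (simp add: tangent_bundle_def)
  then show ?thesis
    using that[OF tb] p assms jac_self[of c p] by (simp add: \<xi>_def)
qed

lemma tb_point_scale:
  assumes "tb_point A c (x, y) = (p, \<xi>)"
  shows "tb_point A c (x, t *\<^sub>R y) = (p, tscale t \<xi>)"
  using assms by (auto simp: tb_point_def tscale_def matrix_vector_mult_scaleR)

end

section \<open>The metric and the energy of a frame\<close>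

locale gap = manifold M A for M :: "'m topology" and A :: "('m, 'n::finite) chart set" +
  fixes lam :: "('m, 'n) frame"
  assumes gap: "gap_space M A lam"
begin

abbreviation "frame_matrix c u \<equiv> (\<chi> \<alpha> i. lam i u c $ \<alpha>) :: real^'n^'n"

lemma lam_tangent:
  assumes "(p, \<xi>) \<in> tangent_bundle M A"
  shows "lam i (p, \<xi>) \<in> tangent_space A p"
  using gap assms by (auto simp: gap_space_def pullback_section_def)

lemma frame_matrix_transform:
  assumes "(p, \<xi>) \<in> tangent_bundle M A" "c \<in> A" "d \<in> A" "p \<in> cdom c" "p \<in> cdom d"
  shows "frame_matrix d (p, \<xi>) = jac c d p ** frame_matrix c (p, \<xi>)"
  using tangent_space_transform[OF lam_tangent[OF assms(1)] assms(2-)]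
  by (simp add: vec_eq_iff matrix_matrix_mult_def matrix_vector_mult_def)

text \<open>A linear relation between the components in one chart propagates to all charts by the
  transformation law, and so is a relation between the frame vectors themselves.\<close>

lemma invertible_frame_matrix:
  assumes "(p, \<xi>) \<in> tangent_bundle M A" "c \<in> A" "p \<in> cdom c"
  shows "invertible (frame_matrix c (p, \<xi>))"
proof -
  have "a = 0" if "frame_matrix c (p, \<xi>) *v a = 0" for a
  proof -
    define \<eta> where "\<eta> d = (\<Sum>i\<in>UNIV. a $ i *\<^sub>R lam i (p, \<xi>) d)" for d
    have \<eta>: "\<eta> d = frame_matrix d (p, \<xi>) *v a" for d
      by (simp add: \<eta>_def vec_eq_iff matrix_vector_mult_def mult.commute)
    have "\<eta> d = 0" for d
    proof (cases "d \<in> A \<and> p \<in> cdom d")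
      case True
      then show ?thesis
        using frame_matrix_transform[OF assms(1,2) _ assms(3), of d] that
        by (simp add: \<eta> flip: matrix_vector_mul_assoc)
    next
      case False
      then have "lam i (p, \<xi>) d = 0" for i
        by (rule tangent_space_outside[OF lam_tangent[OF assms(1)]])
      then show ?thesis
        by (simp add: \<eta>_def)
    qed
    then have "(\<lambda>d. \<Sum>i\<in>UNIV. a $ i *\<^sub>R lam i (p, \<xi>) d) = tzero"
      by (simp add: \<eta>_def tzero_def)
    with gap assms(1) have "\<forall>i. a $ i = 0"
      by (simp add: gap_space_def)
    then show ?thesis
      by (simp add: vec_eq_iff)
  qed
  then show ?thesis
    unfolding invertible_left_inverse matrix_left_invertible_ker by blast
qed

lemma frame_lower_inverse:
  assumes "(p, \<xi>) \<in> tangent_bundle M A" "c \<in> A" "p \<in> cdom c"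
  shows "frame_lower lam c (p, \<xi>) ** frame_matrix c (p, \<xi>) = mat 1"
    and "frame_matrix c (p, \<xi>) ** frame_lower lam c (p, \<xi>) = mat 1"
  unfolding frame_lower_def
  using invertible_frame_matrix[OF assms] by (auto intro: matrix_inv_left matrix_inv_right)

lemma frame_lower_transform:
  assumes "(p, \<xi>) \<in> tangent_bundle M A" "c \<in> A" "d \<in> A" "p \<in> cdom c" "p \<in> cdom d"
  shows "frame_lower lam d (p, \<xi>) = frame_lower lam c (p, \<xi>) ** jac d c p"
proof -
  let ?C = "frame_lower lam c (p, \<xi>)" and ?D = "frame_lower lam d (p, \<xi>)"
  have "?C ** jac d c p = ?C ** jac d c p ** (frame_matrix d (p, \<xi>) ** ?D)"
    using frame_lower_inverse(2) assms by simp
  also have "\<dots> = ?C ** (jac d c p ** jac c d p) ** frame_matrix c (p, \<xi>) ** ?D"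
    by (simp add: frame_matrix_transform[OF assms] matrix_mul_assoc)
  also have "\<dots> = ?D"
    using jac_inverse frame_lower_inverse(1) assms by simp
  finally show ?thesis by simp
qed

lemma gap_metric_eq: "gap_metric lam c u = transpose (frame_lower lam c u) ** frame_lower lam c u"
  by (simp add: gap_metric_def vec_eq_iff matrix_matrix_mult_def transpose_def)

lemma gap_metric_sym: "gap_metric lam c u $ \<mu> $ \<nu> = gap_metric lam c u $ \<nu> $ \<mu>"
  by (simp add: gap_metric_def mult.commute)

text \<open>The metric is the standard inner product of the components with respect to the frame, which is
  why it is positive definite.\<close>

lemma gap_metric_inner:
  "v \<bullet> (gap_metric lam c u *v w) = (frame_lower lam c u *v v) \<bullet> (frame_lower lam c u *v w)"
proof -
  let ?B = "frame_lower lam c u"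
  have "v \<bullet> (gap_metric lam c u *v w) = ((?B *v w) v* ?B) \<bullet> v"
    by (simp add: gap_metric_eq inner_commute flip: matrix_vector_mul_assoc)
  also have "\<dots> = (?B *v w) \<bullet> (?B *v v)"
    by (rule dot_lmul_matrix)
  finally show ?thesis
    by (simp only: inner_commute)
qed

lemma frame_lower_ker:
  assumes "(p, \<xi>) \<in> tangent_bundle M A" "c \<in> A" "p \<in> cdom c"
  shows "frame_lower lam c (p, \<xi>) *v v = 0 \<longleftrightarrow> v = 0"
  using frame_lower_inverse(2)[OF assms]
  by (metis matrix_vector_mul_assoc matrix_vector_mul_lid matrix_vector_mult_0_right)

lemma positive_definite_gap_metric:
  assumes "(p, \<xi>) \<in> tangent_bundle M A" "c \<in> A" "p \<in> cdom c"
  shows "positive_definite (gap_metric lam c (p, \<xi>))"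
  using frame_lower_ker[OF assms] by (simp add: positive_definite_def gap_metric_inner)

lemma smooth_gap_metric:
  assumes "c \<in> A"
  shows "smooth_on (slit_coords c) (\<lambda>z. gap_metric lam c (tb_point A c z) $ \<mu> $ \<nu>)"
proof -
  have "Ck_on k (slit_coords c) (\<lambda>z. lam i (tb_point A c z) c $ \<alpha>)" for k i \<alpha>
    using gap assms
    by (intro Ck_on_bounded_linear[OF bounded_linear_vec_nth open_slit_coords])
       (auto simp: gap_space_def smooth_on_def)
  moreover have "invertible (frame_matrix c (tb_point A c z))" if "z \<in> slit_coords c" for z
  proof -
    have "fst z \<in> cimage c"
      using that by (auto simp: slit_coords_def)
    then obtain p \<xi> where "tb_point A c z = (p, \<xi>)" "(p, \<xi>) \<in> tangent_bundle M A" "p \<in> cdom c"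
      using tb_point_tangent_bundle[OF assms, of "fst z" "snd z"] by (metis prod.collapse)
    then show ?thesis
      using invertible_frame_matrix assms by simp
  qed
  ultimately have "Ck_on k (slit_coords c) (\<lambda>z. frame_lower lam c (tb_point A c z) $ i $ \<mu>)" for k i \<mu>
    unfolding frame_lower_def using assms
    by (intro Ck_on_matrix_inv open_slit_coords) simp_all
  then show ?thesis
    unfolding smooth_on_def gap_metric_def using assms
    by (simp, intro allI Ck_on_sum Ck_on_mult open_slit_coords) simp_all
qed

lemma generalized_lagrange_gap_metric: "generalized_lagrange_space M A (gap_metric lam)"
proof -
  have "gap_metric lam d (p, \<xi>) $ \<mu>' $ \<nu>' =
      (\<Sum>\<mu>\<in>UNIV. \<Sum>\<nu>\<in>UNIV.
         jac d c p $ \<mu> $ \<mu>' * jac d c p $ \<nu> $ \<nu>' * gap_metric lam c (p, \<xi>) $ \<mu> $ \<nu>)"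
    if "(p, \<xi>) \<in> tangent_bundle M A" "c \<in> A" "d \<in> A" "p \<in> cdom c" "p \<in> cdom d"
    for p \<xi> c d \<mu>' \<nu>'
  proof -
    have "gap_metric lam d (p, \<xi>) = transpose (jac d c p) ** (gap_metric lam c (p, \<xi>) ** jac d c p)"
      unfolding gap_metric_eq frame_lower_transform[OF that]
      by (simp add: matrix_transpose_mul matrix_mul_assoc)
    then show ?thesis
      by (simp add: matrix_matrix_mult_def transpose_def sum_distrib_left mult_ac)
  qed
  then have "tensor_field02 M A (gap_metric lam)"
    using smooth_gap_metric by (auto simp: tensor_field02_def)
  moreover have "nondegenerate (gap_metric lam c (p, \<xi>))"
    if "(p, \<xi>) \<in> tangent_bundle M A" "c \<in> A" "p \<in> cdom c" for p \<xi> c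
    using positive_definite_gap_metric[OF that]
    unfolding nondegenerate_def positive_definite_def by (metis less_irrefl)
  ultimately show ?thesis
    using manifold gap_metric_sym by (auto simp: generalized_lagrange_space_def)
qed

lemma quadratic_form_eq_norm:
  "(\<Sum>\<mu>\<in>UNIV. \<Sum>\<nu>\<in>UNIV. gap_metric lam c u $ \<mu> $ \<nu> * y $ \<mu> * y $ \<nu>) =
    (norm (frame_lower lam c u *v y))\<^sup>2"
proof -
  have "(\<Sum>\<mu>\<in>UNIV. \<Sum>\<nu>\<in>UNIV. gap_metric lam c u $ \<mu> $ \<nu> * y $ \<mu> * y $ \<nu>) =
      y \<bullet> (gap_metric lam c u *v y)"
    by (simp add: inner_vec_def matrix_vector_mult_def sum_distrib_left mult_ac)
  then show ?thesis
    by (simp add: gap_metric_inner power2_norm_eq_inner)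
qed

text \<open>The components \<open>\<lambda>\<^bsub>i\<mu>\<^esub> y\<^sup>\<mu>\<close> of the vector with respect to the frame are scalars, so the arbitrary
  chart chosen in the definition of the energy can be exchanged for \<open>c\<close>.\<close>

lemma energy_eq_norm:
  assumes "(p, \<xi>) \<in> tangent_bundle M A" "c \<in> A" "p \<in> cdom c"
  shows "energy A (gap_metric lam) (p, \<xi>) = (norm (frame_lower lam c (p, \<xi>) *v \<xi> c))\<^sup>2"
proof -
  define d where "d = (SOME c. c \<in> A \<and> p \<in> cdom c)"
  have d: "d \<in> A" "p \<in> cdom d"
    using someI[of "\<lambda>c. c \<in> A \<and> p \<in> cdom c" c] assms by (auto simp: d_def)
  have "frame_lower lam d (p, \<xi>) *v \<xi> d =
      frame_lower lam c (p, \<xi>) *v ((jac d c p ** jac c d p) *v \<xi> c)"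
    using assms d tangent_space_transform[of \<xi> p c d]
    by (simp add: frame_lower_transform[OF assms(1,2) d(1) assms(3) d(2)]
        tangent_bundle_def matrix_vector_mul_assoc matrix_mul_assoc)
  then have "frame_lower lam d (p, \<xi>) *v \<xi> d = frame_lower lam c (p, \<xi>) *v \<xi> c"
    using jac_inverse assms d by simp
  then show ?thesis
    by (simp add: energy_def Let_def quadratic_form_eq_norm flip: d_def)
qed

lemma energy_nonneg: "energy A (gap_metric lam) u \<ge> 0"
  by (cases u) (simp add: energy_def Let_def quadratic_form_eq_norm)

lemma energy_eq_0_iff:
  assumes "(p, \<xi>) \<in> tangent_bundle M A"
  shows "energy A (gap_metric lam) (p, \<xi>) = 0 \<longleftrightarrow> \<xi> = tzero"
proof -
  have p: "p \<in> topspace M" "\<xi> \<in> tangent_space A p"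
    using assms by (auto simp: tangent_bundle_def)
  then obtain c where c: "c \<in> A" "p \<in> cdom c"
    using chart_around by blast
  then show ?thesis
    using energy_eq_norm[OF assms c] frame_lower_ker[OF assms c]
      tangent_space_eq_tzero_iff[OF p(2) c] by simp
qed

abbreviation metric_coords :: "('m, 'n) chart \<Rightarrow> (real^'n) \<times> (real^'n) \<Rightarrow> real^'n^'n" where
  "metric_coords c z \<equiv> gap_metric lam c (tb_point A c z)"

definition energy_coords :: "('m, 'n) chart \<Rightarrow> (real^'n) \<times> (real^'n) \<Rightarrow> real" where
  "energy_coords c = energy A (gap_metric lam) \<circ> tb_point A c"

lemma energy_coords_eq:
  assumes "c \<in> A" "fst z \<in> cimage c"
  shows "energy_coords c z =
    (\<Sum>\<mu>\<in>UNIV. \<Sum>\<nu>\<in>UNIV. metric_coords c z $ \<mu> $ \<nu> * snd z $ \<mu> * snd z $ \<nu>)"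
proof -
  obtain p \<xi> where u: "tb_point A c z = (p, \<xi>)" "(p, \<xi>) \<in> tangent_bundle M A"
      "p \<in> cdom c" "\<xi> c = snd z"
    using tb_point_tangent_bundle[OF assms, of "snd z"] by (metis prod.collapse)
  show ?thesis
    unfolding quadratic_form_eq_norm energy_coords_def
    using energy_eq_norm[OF u(2) assms(1) u(3)] u by simp
qed

lemma energy_coords_positive:
  assumes "c \<in> A" "z \<in> slit_coords c"
  shows "energy_coords c z > 0"
proof -
  have z: "fst z \<in> cimage c" "snd z \<noteq> 0"
    using assms by (auto simp: slit_coords_def)
  obtain p \<xi> where u: "tb_point A c z = (p, \<xi>)" "(p, \<xi>) \<in> tangent_bundle M A" "\<xi> c = snd z"
    using tb_point_tangent_bundle[OF assms(1) z(1), of "snd z"] by (metis prod.collapse)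
  then have "\<xi> \<noteq> tzero"
    using z by (auto simp: tzero_def)
  then have "energy_coords c z \<noteq> 0"
    using energy_eq_0_iff[OF u(2)] u(1) by (simp add: energy_coords_def)
  then show ?thesis
    using energy_nonneg[of "tb_point A c z"] by (simp add: energy_coords_def)
qed

lemma metric_coords_positive_definite:
  assumes "c \<in> A" "z \<in> slit_coords c"
  shows "positive_definite (metric_coords c z)"
proof -
  have "fst z \<in> cimage c"
    using assms by (auto simp: slit_coords_def)
  then obtain p \<xi> where "tb_point A c z = (p, \<xi>)" "(p, \<xi>) \<in> tangent_bundle M A" "p \<in> cdom c"
    using tb_point_tangent_bundle[OF assms(1), of "fst z" "snd z"] by (metis prod.collapse)
  then show ?thesis
    using positive_definite_gap_metric assms by simp
qed

text \<open>Transfers the local results to the energy. Off the range of the chart \<open>energy_coords\<close> and the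
  local quadratic form can differ, but \<open>ydot\<close> only looks at points with the same \<open>x\<close>.\<close>

lemma energy_coords_regular:
  assumes c: "c \<in> A"
    and Euler: "\<forall>(x, y) \<in> slit_coords c. \<forall>\<alpha> \<nu>.
      (\<Sum>\<mu>\<in>UNIV. y $ \<mu> * ydot_metric A (gap_metric lam) c \<alpha> \<mu> \<nu> (x, y)) = 0"
  shows "smooth_on (slit_coords c) (energy_coords c)"
    and "continuous_on (cimage c \<times> UNIV) (energy_coords c)"
    and "z \<in> slit_coords c \<Longrightarrow>
      half_hessian A (energy A (gap_metric lam)) c z = metric_coords c z"
proof -
  interpret Euler_metric "cimage c" "metric_coords c"
  proof
    show "smooth_on (cimage c \<times> - {0}) (\<lambda>z. metric_coords c z $ \<mu> $ \<nu>)" for \<mu> \<nu>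
      using smooth_gap_metric[OF c] by (simp add: slit_coords_def)
    show "(\<Sum>\<mu>\<in>UNIV. snd z $ \<mu> * ydot \<alpha> (\<lambda>z. metric_coords c z $ \<mu> $ \<nu>) z) = 0"
      if "z \<in> cimage c \<times> - {0}" for z \<alpha> \<nu>
      using bspec[OF Euler, of z] that
      by (cases z) (simp add: slit_coords_def ydot_metric_def)
  qed (rule open_cimage[OF c] gap_metric_sym)+
  have eq: "quad z = energy_coords c z" if "fst z \<in> cimage c" for z
    using energy_coords_eq[OF c that] by (simp add: quad_def)
  show "smooth_on (slit_coords c) (energy_coords c)"
    unfolding smooth_on_def
  proof
    fix k
    show "Ck_on k (slit_coords c) (energy_coords c)"
      by (rule Ck_on_cong[of _ quad])
        (use smooth_quad eq open_S in \<open>auto simp: smooth_on_def slit_coords_def\<close>)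
  qed
  show "continuous_on (cimage c \<times> UNIV) (energy_coords c)"
    by (rule continuous_on_eq[OF continuous_quad]) (use eq in auto)
  show "half_hessian A (energy A (gap_metric lam)) c z = metric_coords c z"
    if z: "z \<in> slit_coords c"
  proof -
    obtain x y where xy: "z = (x, y)" "x \<in> cimage c" "z \<in> S"
      using z by (auto simp: slit_coords_def)
    have "ydot \<beta> (energy_coords c) (x, y') = ydot \<beta> quad (x, y')" for \<beta> y'
      using eq xy(2) by (simp add: ydot_def)
    then have "ydot \<alpha> (ydot \<beta> (energy_coords c)) z = ydot \<alpha> (ydot \<beta> quad) z" for \<alpha> \<beta>
      by (simp add: xy(1) ydot_def[of \<alpha>])
    then show ?thesis
      using half_hessian_quad[OF xy(3)]
      by (simp add: half_hessian_def vec_eq_iff flip: energy_coords_def)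
  qed
qed

lemma lagrange_space_energy:
  assumes "\<forall>c\<in>A. \<forall>(x, y) \<in> slit_coords c. \<forall>\<alpha> \<nu>.
      (\<Sum>\<mu>\<in>UNIV. y $ \<mu> * ydot_metric A (gap_metric lam) c \<alpha> \<mu> \<nu> (x, y)) = 0"
  shows "lagrange_space M A (energy A (gap_metric lam))"
proof -
  note regular = energy_coords_regular[OF _ bspec[OF assms]]
  have "nondegenerate (half_hessian A (energy A (gap_metric lam)) c z)"
    if "c \<in> A" "z \<in> slit_coords c" for c z
    using metric_coords_positive_definite[OF that] regular(3)[OF that(1) that(1) that(2)]
    unfolding nondegenerate_def positive_definite_def by (metis less_irrefl)
  then show ?thesis
    using manifold regular(1,2)
    by (simp add: lagrange_space_def smooth_on_slit_def continuous_on_tb_def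
        flip: energy_coords_def)
qed

lemma gap_metric_homogeneous:
  assumes "\<forall>i. homogeneous_degree0 M A (lam i)"
    and "(p, \<xi>) \<in> slit_tangent_bundle M A" "a > 0"
  shows "gap_metric lam c (p, tscale a \<xi>) = gap_metric lam c (p, \<xi>)"
proof -
  have "lam i (p, tscale a \<xi>) = lam i (p, \<xi>)" for i
    using bspec[OF assms(1)[rule_format, of i, unfolded homogeneous_degree0_def] assms(2)] assms(3)
    by simp
  then show ?thesis
    by (simp add: gap_metric_def frame_lower_def)
qed

text \<open>Homogeneity of degree zero makes \<open>g\<^bsub>\<alpha>\<nu>\<^esub>\<close> constant along the ray through \<open>y\<close>, so its derivative
  in the direction \<open>y\<close> vanishes; total symmetry moves the index of differentiation.\<close>

lemma Euler_if_symmetric_homogeneous: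
  assumes c: "c \<in> A" and xy: "(x, y) \<in> slit_coords c"
    and sym: "\<forall>z \<in> slit_coords c.
      totally_symmetric3 (\<lambda>\<alpha> \<mu> \<nu>. ydot_metric A (gap_metric lam) c \<alpha> \<mu> \<nu> z)"
    and hom: "\<forall>i. homogeneous_degree0 M A (lam i)"
  shows "(\<Sum>\<mu>\<in>UNIV. y $ \<mu> * ydot_metric A (gap_metric lam) c \<alpha> \<mu> \<nu> (x, y)) = 0"
proof -
  let ?f = "\<lambda>z. metric_coords c z $ \<alpha> $ \<nu>"
  have x: "x \<in> cimage c" "y \<noteq> 0"
    using xy by (auto simp: slit_coords_def)
  obtain p \<xi> where u: "tb_point A c (x, y) = (p, \<xi>)" "(p, \<xi>) \<in> tangent_bundle M A" "\<xi> c = y"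
    using tb_point_tangent_bundle[OF c x(1), of y] by metis
  then have "(p, \<xi>) \<in> slit_tangent_bundle M A"
    using x(2) by (auto simp: slit_tangent_bundle_def tzero_def)
  then have const: "?f (x, y) = ?f (x, t *\<^sub>R y)" if "t > 0" for t
    using gap_metric_homogeneous[OF hom _ that] tb_point_scale[OF u(1)] u(1) by simp
  have "?f differentiable (at (x, 1 *\<^sub>R y))"
    using smooth_on_differentiable[OF smooth_gap_metric[OF c] xy] by simp
  from derivative_along_ray[OF this]
  have "((\<lambda>t. ?f (x, t *\<^sub>R y)) has_field_derivative
      (\<Sum>\<mu>\<in>UNIV. y $ \<mu> * ydot \<mu> ?f (x, y))) (at 1)"
    by simp
  moreover have "((\<lambda>t. ?f (x, t *\<^sub>R y)) has_field_derivative 0) (at 1)"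
    by (rule has_field_derivative_transform_within_open
        [where S = "{0<..}" and f = "\<lambda>_. ?f (x, y)"])
      (use const in auto)
  ultimately have "(\<Sum>\<mu>\<in>UNIV. y $ \<mu> * ydot \<mu> ?f (x, y)) = 0"
    by (rule DERIV_unique)
  moreover have "ydot_metric A (gap_metric lam) c \<alpha> \<mu> \<nu> (x, y) = ydot \<mu> ?f (x, y)" for \<mu>
    using bspec[OF sym xy] unfolding totally_symmetric3_def by (simp add: ydot_metric_def)
  ultimately show ?thesis
    by simp
qed

lemma finsler_space_sqrt_energy:
  assumes sym: "\<forall>c\<in>A. \<forall>z \<in> slit_coords c.
      totally_symmetric3 (\<lambda>\<alpha> \<mu> \<nu>. ydot_metric A (gap_metric lam) c \<alpha> \<mu> \<nu> z)"
    and hom: "\<forall>i. homogeneous_degree0 M A (lam i)"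
  shows "finsler_space M A (\<lambda>u. sqrt (energy A (gap_metric lam) u))"
proof -
  have Euler: "\<forall>(x, y) \<in> slit_coords c. \<forall>\<alpha> \<nu>.
      (\<Sum>\<mu>\<in>UNIV. y $ \<mu> * ydot_metric A (gap_metric lam) c \<alpha> \<mu> \<nu> (x, y)) = 0"
    if "c \<in> A" for c
    using Euler_if_symmetric_homogeneous[OF that _ bspec[OF sym that] hom] by blast
  note regular = energy_coords_regular[OF _ Euler]
  have comp: "(\<lambda>u. sqrt (energy A (gap_metric lam) u)) \<circ> tb_point A c =
      (\<lambda>z. sqrt (energy_coords c z))" for c
    by (auto simp: energy_coords_def)
  have smooth: "smooth_on (slit_coords c) (\<lambda>z. sqrt (energy_coords c z))" if "c \<in> A" for c
    using regular(1)[OF that that] energy_coords_positive[OF that] open_slit_coords[OF that]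
    unfolding smooth_on_def by (auto intro: Ck_on_sqrt)
  have cont: "continuous_on (cimage c \<times> UNIV) (\<lambda>z. sqrt (energy_coords c z))" if "c \<in> A" for c
    using regular(2)[OF that that] by (rule continuous_on_real_sqrt)
  \<comment> \<open>The zero vector is treated separately: homogeneity of the frame is only assumed off the zero section.\<close>
  have scale: "energy A (gap_metric lam) (p, tscale a \<xi>) = a\<^sup>2 * energy A (gap_metric lam) (p, \<xi>)"
    if u: "(p, \<xi>) \<in> tangent_bundle M A" and "a > 0" for p \<xi> a
  proof (cases "\<xi> = tzero")
    case True
    then have "tscale a \<xi> = \<xi>"
      by (simp add: tscale_def tzero_def)
    then show ?thesis
      using energy_eq_0_iff[OF u] True by simp
  next
    case False
    then have "(p, \<xi>) \<in> slit_tangent_bundle M A"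
      using u by (simp add: slit_tangent_bundle_def)
    then show ?thesis
      using gap_metric_homogeneous[OF hom _ \<open>a > 0\<close>]
      by (simp add: energy_def Let_def tscale_def sum_distrib_left power2_eq_square mult_ac)
  qed
  have "(\<lambda>u. (sqrt (energy A (gap_metric lam) u))\<^sup>2) = energy A (gap_metric lam)"
    using energy_nonneg by auto
  then have "positive_definite
      (half_hessian A (\<lambda>u. (sqrt (energy A (gap_metric lam) u))\<^sup>2) c z)"
    if "c \<in> A" "z \<in> slit_coords c" for c z
    using metric_coords_positive_definite[OF that] regular(3)[OF that(1) that(1) that(2)] by simp
  with smooth cont show ?thesis
    using manifold energy_nonneg energy_eq_0_iff scale
    by (auto simp: finsler_space_def smooth_on_slit_def continuous_on_tb_def comp real_sqrt_mult)
qed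

end

theorem theorem3p1:
  fixes M :: "'m topology"
    and A :: "('m, 'n::finite) chart set"
    and lam :: "('m, 'n) frame"
    and g :: "('m, 'n) tensor02"
    and L F :: "'m \<times> ('m, 'n) tvec \<Rightarrow> real"
  assumes gap: "gap_space M A lam"
    and g: "g = gap_metric lam"
    and L: "L = (\<lambda>u. energy A g u)"
    and F: "F = (\<lambda>u. sqrt (energy A g u))"
  shows "generalized_lagrange_space M A g \<and>
    ((\<forall>c\<in>A. \<forall>(x, y) \<in> slit_coords c. \<forall>\<alpha> \<nu>.
        (\<Sum>\<mu>\<in>UNIV. y $ \<mu> * ydot_metric A g c \<alpha> \<mu> \<nu> (x, y)) = 0)
      \<longrightarrow> lagrange_space M A L) \<and>
    ((\<forall>c\<in>A. \<forall>z \<in> slit_coords c. totally_symmetric3 (\<lambda>\<alpha> \<mu> \<nu>. ydot_metric A g c \<alpha> \<mu> \<nu> z)) \<and>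
      (\<forall>i. homogeneous_degree0 M A (lam i))
      \<longrightarrow> finsler_space M A F)"
proof -
  interpret gap M A lam
    by unfold_locales (use gap in \<open>auto simp: gap_space_def\<close>)
  show ?thesis
    unfolding g L F
    using generalized_lagrange_gap_metric lagrange_space_energy finsler_space_sqrt_energy by blast
qed

end
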